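(* Let $R$ be a $G$-graded ring, let $M$ be a $G$-graded weakly topological $R$-module, let $P\subseteq\Upsilon_M$ be a subset and let $J\in\Upsilon_{M,I}$ for some $I\in GWSpec(R)$. Then, for the Zariski topology on $\Upsilon_M$: (1) $Cl(P)=\chi(\eta(P))$, and hence $P$ is closed if and only if $P=\chi(\eta(P))$. In particular, $Cl(\{J\})=\chi(J)$. (2) If $\{0\}\in P$, then $P$ is dense in $\Upsilon_M$. (3) $\Upsilon_M$ is a $T_0$-space.
   Context: Conventions: $G$ is an abelian group with identity $e$; rings are commutative with identity and modules are unital. A ring $R$ is $G$-graded if $R=\bigoplus_{g\in G}R_g$ with additive subgroups $R_g$ and $R_gR_h\subseteq R_{gh}$; $h(R)=\bigcup_{g}R_g$. An ideal $I$ of $R$ is graded if $I=\bigoplus_g (I\cap R_g)$. An $R$-module $M$ is $G$-graded if $M=\bigoplus_{g}M_g$ with additive subgroups $M_g$ and $R_gM_h\subseteq M_{gh}$. A submodule $P$ of $M$ is graded if $P=\bigoplus_g (P\cap M_g)$. Put $(P:_RM)=\{r\in R: rM\subseteq P\}$. A proper graded ideal $I$ of $R$ is graded weakly prime if whenever $a,b\in h(R)$ and $0\neq ab\in I$, then $a\in I$ or $b\in I$. $GWSpec(R)$ is the set of graded weakly prime ideals of $R$. A graded submodule $P$ of $M$ is graded pseudo weakly prime if $(P:_RM)$ is a graded weakly prime ideal of $R$; $\Upsilon_M$ is the set of all graded pseudo weakly prime submodules of $M$, and for $I\in GWSpec(R)$, $\Upsilon_{M,I}=\{P\in\Upsilon_M:(P:_RM)=I\}$.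 A graded submodule of $M$ is graded pseudo weakly semiprime if it is an intersection of graded pseudo weakly prime submodules of $M$. A graded pseudo weakly prime submodule $P$ of $M$ is graded weakly extraordinary if whenever $I,J$ are graded pseudo weakly semiprime submodules of $M$ with $\{0\}\neq I\cap J\subseteq P$, then $I\subseteq P$ or $J\subseteq P$. $M$ is $G$-graded weakly topological if $\Upsilon_M=\emptyset$ or every graded pseudo weakly prime submodule of $M$ is graded weakly extraordinary. For a graded submodule $N$ of $M$, $\chi(N)=\{I\in\Upsilon_M: N\subseteq I\}$. The Zariski topology on $\Upsilon_M$ is the topology whose closed sets are exactly the sets $\chi(N)$, $N$ a graded submodule of $M$. For a subset $P\subseteq\Upsilon_M$, $\eta(P)$ is the intersection of all elements of $P$ (with $\eta(\emptyset)=M$), and $Cl(P)$ is the closure of $P$ in $\Upsilon_M$.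
   Formalization: It is assumed that the sets χ(N) are the closed sets of a topology on Υ_M; being graded weakly topological does not imply this: for R=M=ℤ/6, trivially graded, χ((2))∪χ((3)) is not of the form χ(N). *)

theory Defs
  imports "HOL-Analysis.Abstract_Topological_Spaces" "HOL-Algebra.Module" "HOL-Algebra.Ideal"
begin

text \<open>
  \<open>H\<close> is the internal direct sum of the additive subgroups \<open>A i\<close> for \<open>i \<in> I\<close>: every element
  of \<open>H\<close>, and nothing else, is the sum of a unique finitely supported family \<open>f\<close> with
  \<open>f i \<in> A i\<close>. The families are extensional functions on \<open>I\<close>, so that they are determined by
  their values on \<open>I\<close>; \<^const>\<open>finsum\<close> is only taken over the finite support.
\<close>

definition internal_direct_sum ::
    "('a, 'b) ring_scheme \<Rightarrow> 'i set \<Rightarrow> ('i \<Rightarrow> 'a set) \<Rightarrow> 'a set \<Rightarrow> bool" where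
  "internal_direct_sum S I A H \<longleftrightarrow>
     (\<forall>i\<in>I. additive_subgroup (A i) S) \<and>
     bij_betw (\<lambda>f. finsum S f {i \<in> I. f i \<noteq> \<zero>\<^bsub>S\<^esub>})
       {f \<in> (\<Pi>\<^sub>E i\<in>I. A i). finite {i \<in> I. f i \<noteq> \<zero>\<^bsub>S\<^esub>}} H"

locale graded_ring = G?: comm_group G + R?: cring R
  for G :: "('g, 'x) monoid_scheme" and R :: "('r, 'y) ring_scheme" and A :: "'g \<Rightarrow> 'r set" +
  assumes ring_direct_sum: "internal_direct_sum R (carrier G) A (carrier R)"
    and ring_mult_graded: "\<And>g h r s. \<lbrakk>g \<in> carrier G; h \<in> carrier G; r \<in> A g; s \<in> A h\<rbrakk>
          \<Longrightarrow> r \<otimes>\<^bsub>R\<^esub> s \<in> A (g \<otimes>\<^bsub>G\<^esub> h)"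

locale graded_module = graded_ring G R A + Module.module R M
  for G :: "('g, 'x) monoid_scheme" and R :: "('r, 'y) ring_scheme" and A :: "'g \<Rightarrow> 'r set"
    and M :: "('r, 'm, 'z) module_scheme" and B :: "'g \<Rightarrow> 'm set" +
  assumes module_direct_sum: "internal_direct_sum M (carrier G) B (carrier M)"
    and smult_graded: "\<And>g h r m. \<lbrakk>g \<in> carrier G; h \<in> carrier G; r \<in> A g; m \<in> B h\<rbrakk>
          \<Longrightarrow> r \<odot>\<^bsub>M\<^esub> m \<in> B (g \<otimes>\<^bsub>G\<^esub> h)"

definition homogeneous :: "('g, 'x) monoid_scheme \<Rightarrow> ('g \<Rightarrow> 'r set) \<Rightarrow> 'r set" where
  "homogeneous G A = (\<Union>g\<in>carrier G. A g)"

definition graded_ideal ::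
    "('g, 'x) monoid_scheme \<Rightarrow> ('r, 'y) ring_scheme \<Rightarrow> ('g \<Rightarrow> 'r set) \<Rightarrow> 'r set \<Rightarrow> bool" where
  "graded_ideal G R A I \<longleftrightarrow>
     ideal I R \<and> internal_direct_sum R (carrier G) (\<lambda>g. I \<inter> A g) I"

definition graded_submodule ::
    "('g, 'x) monoid_scheme \<Rightarrow> ('r, 'y) ring_scheme \<Rightarrow> ('r, 'm, 'z) module_scheme \<Rightarrow>
     ('g \<Rightarrow> 'm set) \<Rightarrow> 'm set \<Rightarrow> bool" where
  "graded_submodule G R M B P \<longleftrightarrow>
     submodule P R M \<and> internal_direct_sum M (carrier G) (\<lambda>g. P \<inter> B g) P"

definition residual ::
    "('r, 'y) ring_scheme \<Rightarrow> ('r, 'm, 'z) module_scheme \<Rightarrow> 'm set \<Rightarrow> 'r set" where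
  "residual R M P = {r \<in> carrier R. \<forall>m\<in>carrier M. r \<odot>\<^bsub>M\<^esub> m \<in> P}"

definition graded_weakly_prime ::
    "('g, 'x) monoid_scheme \<Rightarrow> ('r, 'y) ring_scheme \<Rightarrow> ('g \<Rightarrow> 'r set) \<Rightarrow> 'r set \<Rightarrow> bool" where
  "graded_weakly_prime G R A I \<longleftrightarrow>
     graded_ideal G R A I \<and> I \<noteq> carrier R \<and>
     (\<forall>a\<in>homogeneous G A. \<forall>b\<in>homogeneous G A.
        a \<otimes>\<^bsub>R\<^esub> b \<noteq> \<zero>\<^bsub>R\<^esub> \<and> a \<otimes>\<^bsub>R\<^esub> b \<in> I \<longrightarrow> a \<in> I \<or> b \<in> I)"

definition GWSpec ::
    "('g, 'x) monoid_scheme \<Rightarrow> ('r, 'y) ring_scheme \<Rightarrow> ('g \<Rightarrow> 'r set) \<Rightarrow> 'r set set" where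
  "GWSpec G R A = {I. graded_weakly_prime G R A I}"

definition graded_pseudo_weakly_prime ::
    "('g, 'x) monoid_scheme \<Rightarrow> ('r, 'y) ring_scheme \<Rightarrow> ('g \<Rightarrow> 'r set) \<Rightarrow>
     ('r, 'm, 'z) module_scheme \<Rightarrow> ('g \<Rightarrow> 'm set) \<Rightarrow> 'm set \<Rightarrow> bool" where
  "graded_pseudo_weakly_prime G R A M B P \<longleftrightarrow>
     graded_submodule G R M B P \<and> graded_weakly_prime G R A (residual R M P)"

text \<open>The set \<open>\<Upsilon>\<^sub>M\<close> and its parts \<open>\<Upsilon>\<^sub>M\<^sub>,\<^sub>I\<close>.\<close>

definition Upsilon ::
    "('g, 'x) monoid_scheme \<Rightarrow> ('r, 'y) ring_scheme \<Rightarrow> ('g \<Rightarrow> 'r set) \<Rightarrow>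
     ('r, 'm, 'z) module_scheme \<Rightarrow> ('g \<Rightarrow> 'm set) \<Rightarrow> 'm set set" where
  "Upsilon G R A M B = {P. graded_pseudo_weakly_prime G R A M B P}"

definition Upsilon_at ::
    "('g, 'x) monoid_scheme \<Rightarrow> ('r, 'y) ring_scheme \<Rightarrow> ('g \<Rightarrow> 'r set) \<Rightarrow>
     ('r, 'm, 'z) module_scheme \<Rightarrow> ('g \<Rightarrow> 'm set) \<Rightarrow> 'r set \<Rightarrow> 'm set set" where
  "Upsilon_at G R A M B I = {P \<in> Upsilon G R A M B. residual R M P = I}"

text \<open>Intersecting with the carrier only matters for \<open>P = {}\<close>, where it gives \<open>\<eta>(\<emptyset>) = M\<close>.\<close>

definition eta :: "('r, 'm, 'z) module_scheme \<Rightarrow> 'm set set \<Rightarrow> 'm set" where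
  "eta M P = carrier M \<inter> \<Inter>P"

definition graded_pseudo_weakly_semiprime ::
    "('g, 'x) monoid_scheme \<Rightarrow> ('r, 'y) ring_scheme \<Rightarrow> ('g \<Rightarrow> 'r set) \<Rightarrow>
     ('r, 'm, 'z) module_scheme \<Rightarrow> ('g \<Rightarrow> 'm set) \<Rightarrow> 'm set \<Rightarrow> bool" where
  "graded_pseudo_weakly_semiprime G R A M B N \<longleftrightarrow>
     graded_submodule G R M B N \<and> (\<exists>P \<subseteq> Upsilon G R A M B. N = eta M P)"

definition graded_weakly_extraordinary ::
    "('g, 'x) monoid_scheme \<Rightarrow> ('r, 'y) ring_scheme \<Rightarrow> ('g \<Rightarrow> 'r set) \<Rightarrow>
     ('r, 'm, 'z) module_scheme \<Rightarrow> ('g \<Rightarrow> 'm set) \<Rightarrow> 'm set \<Rightarrow> bool" where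
  "graded_weakly_extraordinary G R A M B P \<longleftrightarrow>
     graded_pseudo_weakly_prime G R A M B P \<and>
     (\<forall>I J. graded_pseudo_weakly_semiprime G R A M B I \<and>
            graded_pseudo_weakly_semiprime G R A M B J \<and>
            I \<inter> J \<noteq> {\<zero>\<^bsub>M\<^esub>} \<and> I \<inter> J \<subseteq> P \<longrightarrow> I \<subseteq> P \<or> J \<subseteq> P)"

definition graded_weakly_topological ::
    "('g, 'x) monoid_scheme \<Rightarrow> ('r, 'y) ring_scheme \<Rightarrow> ('g \<Rightarrow> 'r set) \<Rightarrow>
     ('r, 'm, 'z) module_scheme \<Rightarrow> ('g \<Rightarrow> 'm set) \<Rightarrow> bool" where
  "graded_weakly_topological G R A M B \<longleftrightarrow>
     Upsilon G R A M B = {} \<or>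
     (\<forall>P\<in>Upsilon G R A M B. graded_weakly_extraordinary G R A M B P)"

definition chi ::
    "('g, 'x) monoid_scheme \<Rightarrow> ('r, 'y) ring_scheme \<Rightarrow> ('g \<Rightarrow> 'r set) \<Rightarrow>
     ('r, 'm, 'z) module_scheme \<Rightarrow> ('g \<Rightarrow> 'm set) \<Rightarrow> 'm set \<Rightarrow> 'm set set" where
  "chi G R A M B N = {P \<in> Upsilon G R A M B. N \<subseteq> P}"

text \<open>
  \<open>T\<close> is the Zariski topology on \<open>\<Upsilon>\<^sub>M\<close>. This determines \<open>T\<close> uniquely, but does not make it
  exist: finite unions of sets \<open>\<chi>(N)\<close> need not be of this form. For example, for the trivially
  graded ring \<open>\<int>/6\<close> as a module over itself, \<open>\<chi>((2)) \<union> \<chi>((3))\<close> is not of this form, although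
  this module is graded weakly topological.
\<close>

definition is_zariski_topology ::
    "('g, 'x) monoid_scheme \<Rightarrow> ('r, 'y) ring_scheme \<Rightarrow> ('g \<Rightarrow> 'r set) \<Rightarrow>
     ('r, 'm, 'z) module_scheme \<Rightarrow> ('g \<Rightarrow> 'm set) \<Rightarrow> 'm set topology \<Rightarrow> bool" where
  "is_zariski_topology G R A M B T \<longleftrightarrow>
     topspace T = Upsilon G R A M B \<and>
     (\<forall>C. closedin T C \<longleftrightarrow> (\<exists>N. graded_submodule G R M B N \<and> C = chi G R A M B N))"

end

theory Submission
  imports Defs
begin

text \<open>
  The Zariski-closed sets are the sets \<open>\<chi>(N)\<close>, so the closure of \<open>P\<close> is the least \<open>\<chi>(N)\<close>
  containing \<open>P\<close>. Now \<open>P \<subseteq> \<chi>(N)\<close> says that \<open>N\<close> lies in every member of \<open>P\<close>, that is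
  \<open>N \<subseteq> \<eta>(P)\<close>, and then \<open>\<chi>(\<eta>(P)) \<subseteq> \<chi>(N)\<close>; hence \<open>\<chi>(\<eta>(P))\<close> is this closure as soon as
  \<open>\<eta>(P)\<close> is itself a graded submodule. For the latter, a submodule is graded exactly when it
  contains the homogeneous components of each of its elements
  (\<open>graded_submodule_iff\<close>), a condition that is stable under arbitrary intersections
  (\<open>graded_submodule_eta\<close>).

  Density follows because \<open>\<eta>(P) = {0}\<close> when \<open>{0} \<in> P\<close>, and the \<open>T\<^sub>0\<close> property because
  \<open>\<chi>(J)\<close> has \<open>J\<close> as its least element, so that points with equal closures coincide.
\<close>

lemma (in abelian_group) finsum_mem_additive_subgroup:
  assumes H: "additive_subgroup H G" and "f \<in> F \<rightarrow> H"
  shows "finsum G f F \<in> H"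
proof -
  interpret H: additive_subgroup H G by (rule H)
  have "finite F \<Longrightarrow> f \<in> F \<rightarrow> H \<Longrightarrow> finsum G f F \<in> H"
  proof (induction F rule: finite_induct)
    case empty
    then show ?case by simp
  next
    case (insert x F)
    then have "f \<in> F \<rightarrow> carrier G" "f x \<in> carrier G"
      using H.a_subset by auto
    with insert show ?case by (simp add: Pi_iff)
  qed
  with assms(2) show ?thesis
    by (cases "finite F") (auto simp: finsum_infinite)
qed

text \<open>
  The families \<open>f\<close> below are the decompositions into components of the elements of \<open>C\<close>: a
  subgroup of an internal direct sum is the direct sum of its intersections with the summands if
  and only if it contains the components of each of its elements.
\<close>

lemma (in abelian_group) internal_direct_sum_Int_iff:
  assumes sum: "internal_direct_sum G I A C"
    and H: "additive_subgroup H G" and "H \<subseteq> C"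
  shows "internal_direct_sum G I (\<lambda>i. H \<inter> A i) H \<longleftrightarrow>
    (\<forall>f \<in> (\<Pi>\<^sub>E i\<in>I. A i). finite {i \<in> I. f i \<noteq> \<zero>} \<longrightarrow>
       finsum G f {i \<in> I. f i \<noteq> \<zero>} \<in> H \<longrightarrow> (\<forall>i\<in>I. f i \<in> H))"
proof -
  let ?s = "\<lambda>f. finsum G f {i \<in> I. f i \<noteq> \<zero>}"
  let ?D = "{f \<in> (\<Pi>\<^sub>E i\<in>I. A i). finite {i \<in> I. f i \<noteq> \<zero>}}"
  let ?E = "{f \<in> (\<Pi>\<^sub>E i\<in>I. H \<inter> A i). finite {i \<in> I. f i \<noteq> \<zero>}}"
  have A: "\<And>i. i \<in> I \<Longrightarrow> additive_subgroup (A i) G"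
    and inj: "inj_on ?s ?D" and onto: "?s ` ?D = C"
    using sum by (auto simp: internal_direct_sum_def bij_betw_def)
  have "?E \<subseteq> ?D"
    by (auto simp: PiE_iff)
  with inj have "inj_on ?s ?E"
    by (rule inj_on_subset)
  moreover have "additive_subgroup (H \<inter> A i) G" if "i \<in> I" for i
    using A[OF that] H unfolding additive_subgroup_def by (rule add.subgroups_Inter_pair[rotated])
  ultimately have "internal_direct_sum G I (\<lambda>i. H \<inter> A i) H \<longleftrightarrow> ?s ` ?E = H"
    by (simp add: internal_direct_sum_def bij_betw_def)
  also have "\<dots> \<longleftrightarrow> (\<forall>f\<in>?D. ?s f \<in> H \<longrightarrow> (\<forall>i\<in>I. f i \<in> H))"
  proof (intro iffI ballI impI)
    fix f i
    assume *: "?s ` ?E = H" "f \<in> ?D" "?s f \<in> H" "i \<in> I"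
    then obtain g where g: "g \<in> ?E" "?s f = ?s g"
      by (metis (no_types, lifting) imageE)
    with \<open>?E \<subseteq> ?D\<close> *(2) have "f = g"
      by (intro inj_onD[OF inj]) auto
    with g(1) *(4) show "f i \<in> H"
      by (auto simp: PiE_iff)
  next
    assume *: "\<forall>f\<in>?D. ?s f \<in> H \<longrightarrow> (\<forall>i\<in>I. f i \<in> H)"
    show "?s ` ?E = H"
    proof
      show "?s ` ?E \<subseteq> H"
        by (auto simp: PiE_iff intro!: finsum_mem_additive_subgroup[OF H])
      show "H \<subseteq> ?s ` ?E"
      proof
        fix x
        assume "x \<in> H"
        with onto \<open>H \<subseteq> C\<close> obtain f where f: "f \<in> ?D" "x = ?s f"
          by (metis (no_types, lifting) imageE subsetD)
        with * \<open>x \<in> H\<close> have "f \<in> ?E"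
          by (auto simp: PiE_iff)
        with f(2) show "x \<in> ?s ` ?E"
          by blast
      qed
    qed
  qed
  finally show ?thesis
    by blast
qed

context graded_module
begin

lemma graded_submodule_iff:
  "graded_submodule G R M B N \<longleftrightarrow> submodule N R M \<and>
    (\<forall>f \<in> (\<Pi>\<^sub>E g\<in>carrier G. B g). finite {g \<in> carrier G. f g \<noteq> \<zero>\<^bsub>M\<^esub>} \<longrightarrow>
       finsum M f {g \<in> carrier G. f g \<noteq> \<zero>\<^bsub>M\<^esub>} \<in> N \<longrightarrow> (\<forall>g\<in>carrier G. f g \<in> N))"
proof (cases "submodule N R M")
  case True
  then interpret N: submodule N R M .
  have "additive_subgroup N M"
    unfolding additive_subgroup_def by (rule N.subgroup_axioms)
  moreover have "N \<subseteq> carrier M"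
    using N.subset by simp
  ultimately show ?thesis
    using True M.internal_direct_sum_Int_iff[OF module_direct_sum]
    by (simp add: graded_submodule_def)
qed (simp add: graded_submodule_def)

lemma zero_mem_submodule: "submodule N R M \<Longrightarrow> \<zero>\<^bsub>M\<^esub> \<in> N"
  using subgroup.one_closed[OF submodule.axioms(1)] by fastforce

lemma submodule_eta:
  assumes "\<And>N. N \<in> P \<Longrightarrow> submodule N R M"
  shows "submodule (eta M P) R M"
proof (rule submoduleI)
  show "eta M P \<subseteq> carrier M"
    by (simp add: eta_def)
  show "\<zero>\<^bsub>M\<^esub> \<in> eta M P"
    using zero_mem_submodule[OF assms] by (auto simp: eta_def)
qed (use assms in \<open>auto simp: eta_def dest: submoduleE\<close>)

lemma graded_submodule_eta:
  assumes "\<And>N. N \<in> P \<Longrightarrow> graded_submodule G R M B N"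
  shows "graded_submodule G R M B (eta M P)"
proof -
  have "submodule (eta M P) R M"
    using assms by (intro submodule_eta) (simp add: graded_submodule_def)
  \<comment> \<open>Needed for \<open>P = {}\<close>, where \<open>\<eta>(P)\<close> is all of \<open>M\<close>.\<close>
  moreover have "B g \<subseteq> carrier M" if "g \<in> carrier G" for g
    using module_direct_sum that
    by (auto simp: internal_direct_sum_def intro: additive_subgroup.a_Hcarr)
  ultimately show ?thesis
    using assms unfolding graded_submodule_iff eta_def by (fastforce simp: PiE_iff)
qed

lemma zariski_closure_of:
  assumes T: "is_zariski_topology G R A M B T" and P: "P \<subseteq> Upsilon G R A M B"
  shows "T closure_of P = chi G R A M B (eta M P)"
proof (rule closure_of_unique)
  show "P \<subseteq> chi G R A M B (eta M P)"
    using P by (auto simp: chi_def eta_def)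
  have "graded_submodule G R M B (eta M P)"
    using P by (intro graded_submodule_eta)
      (auto simp: Upsilon_def graded_pseudo_weakly_prime_def)
  with T show "closedin T (chi G R A M B (eta M P))"
    by (auto simp: is_zariski_topology_def)
  fix C
  assume "P \<subseteq> C" "closedin T C"
  with T obtain N where N: "graded_submodule G R M B N" and C: "C = chi G R A M B N"
    by (auto simp: is_zariski_topology_def)
  from N have "N \<subseteq> carrier M"
    by (auto simp: graded_submodule_def dest: submoduleE(1))
  with \<open>P \<subseteq> C\<close> have "N \<subseteq> eta M P"
    by (auto simp: C chi_def eta_def)
  then show "chi G R A M B (eta M P) \<subseteq> C"
    by (auto simp: C chi_def)
qed

lemma Upsilon_submodule: "N \<in> Upsilon G R A M B \<Longrightarrow> submodule N R M"
  by (simp add: Upsilon_def graded_pseudo_weakly_prime_def graded_submodule_def)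

lemma zariski_closure_of_singleton:
  assumes "is_zariski_topology G R A M B T" and J: "J \<in> Upsilon G R A M B"
  shows "T closure_of {J} = chi G R A M B J"
proof -
  have "eta M {J} = J"
    using submoduleE(1)[OF Upsilon_submodule[OF J]] by (auto simp: eta_def)
  then show ?thesis
    using zariski_closure_of[of T "{J}"] assms by simp
qed

lemma zariski_t0_space:
  assumes T: "is_zariski_topology G R A M B T"
  shows "t0_space T"
  unfolding t0_space_closure_of_sing
proof (intro ballI impI)
  fix J K
  assume "J \<in> topspace T" "K \<in> topspace T" and eq: "T closure_of {J} = T closure_of {K}"
  with T have J: "J \<in> Upsilon G R A M B" and K: "K \<in> Upsilon G R A M B"
    by (auto simp: is_zariski_topology_def)
  with eq have "chi G R A M B J = chi G R A M B K"
    using zariski_closure_of_singleton[OF T] by simp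
  with J K show "J = K"
    by (auto simp: chi_def)
qed

end

theorem theorem3p3:
  fixes G :: "('g, 'x) monoid_scheme"
    and R :: "('r, 'y) ring_scheme" and A :: "'g \<Rightarrow> 'r set"
    and M :: "('r, 'm, 'z) module_scheme" and B :: "'g \<Rightarrow> 'm set"
    and T :: "'m set topology"
    and P :: "'m set set" and I :: "'r set" and J :: "'m set"
  assumes "graded_module G R A M B"
    and "graded_weakly_topological G R A M B"
    and "is_zariski_topology G R A M B T"
    and "P \<subseteq> Upsilon G R A M B"
    and "I \<in> GWSpec G R A"
    and "J \<in> Upsilon_at G R A M B I"
  shows "(T closure_of P = chi G R A M B (eta M P) \<and>
          (closedin T P \<longleftrightarrow> P = chi G R A M B (eta M P)) \<and>
          T closure_of {J} = chi G R A M B J) \<and>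
         ({\<zero>\<^bsub>M\<^esub>} \<in> P \<longrightarrow> T closure_of P = topspace T) \<and>
         t0_space T"
proof -
  interpret graded_module G R A M B by fact
  note T = assms(3)
  have cl: "T closure_of P = chi G R A M B (eta M P)"
    using T assms(4) by (rule zariski_closure_of)
  then have "closedin T P \<longleftrightarrow> P = chi G R A M B (eta M P)"
    by (metis closedin_closure_of closure_of_closedin)
  moreover have "T closure_of {J} = chi G R A M B J"
    using T assms(6) by (intro zariski_closure_of_singleton) (auto simp: Upsilon_at_def)
  moreover have "T closure_of P = topspace T" if "{\<zero>\<^bsub>M\<^esub>} \<in> P"
  proof -
    have "eta M P \<subseteq> {\<zero>\<^bsub>M\<^esub>}"
      using that by (auto simp: eta_def)
    then have "chi G R A M B (eta M P) = Upsilon G R A M B"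
      using zero_mem_submodule[OF Upsilon_submodule] by (auto simp: chi_def)
    with cl T show ?thesis
      by (simp add: is_zariski_topology_def)
  qed
  ultimately show ?thesis
    using cl zariski_t0_space[OF T] by blast
qed

end
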